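(* Let $n\ge k\ge1$ be integers and let $X_1,\dots,X_n$ be mutually independent non-negative random variables with finite expectations and everywhere-continuous cumulative distribution functions. Let $\Psi=\{\psi\in[0,1]^n:\|\psi\|_1=k\}$, $G_i(r)=\mathbb{E}[[X_i-r]^+]$, and $\bar H(r,\psi)=r+\sum_{i\in[n]}G_i(r)\psi_i$. Let $r^*$ be an optimal solution to $\min_{r\in\mathbb{R}}\max_{\psi\in\Psi}\bar H(r,\psi)$. Then there exists an optimal solution $\psi^*$ to $\max_{\psi\in\Psi}\bar H(r^*,\psi)$ such that (1) $\sum_{i\in[n]}\Pr[X_i\ge r^*]\cdot\psi^*_i=1$, and (2) $\psi^*$ has at most two fractional (i.e., non-integer) coordinates.
   Context: $[x]^+=\max\{x,0\}$, $[n]=\{1,\dots,n\}$. *)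

theory Defs
  imports "HOL-Probability.Probability"
begin

text \<open>
  Vectors of dimension \<open>n\<close> are functions on \<open>{1..n}\<close>, fixed to \<open>undefined\<close> outside, so that
  \<open>Psi n k\<close> is exactly the set of vectors in the unit cube with 1-norm \<open>k\<close>.
\<close>

definition Psi :: "nat \<Rightarrow> nat \<Rightarrow> (nat \<Rightarrow> real) set" where
  "Psi n k = {\<psi> \<in> {1..n} \<rightarrow>\<^sub>E {0..1}. (\<Sum>i\<in>{1..n}. \<bar>\<psi> i\<bar>) = real k}"

definition G :: "'a measure \<Rightarrow> (nat \<Rightarrow> 'a \<Rightarrow> real) \<Rightarrow> nat \<Rightarrow> real \<Rightarrow> real" where
  "G M X i r = (\<integral>\<omega>. max (X i \<omega> - r) 0 \<partial>M)"

definition Hbar :: "'a measure \<Rightarrow> (nat \<Rightarrow> 'a \<Rightarrow> real) \<Rightarrow> nat \<Rightarrow> real \<Rightarrow> (nat \<Rightarrow> real) \<Rightarrow> real" where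
  "Hbar M X n r \<psi> = r + (\<Sum>i\<in>{1..n}. G M X i r * \<psi> i)"

text \<open>
  For \<open>k \<le> n\<close> the set \<open>Psi n k\<close> is nonempty and compact and \<open>Hbar\<close> is affine in \<open>\<psi>\<close>, so the
  supremum below is an attained maximum.
\<close>

definition minimax_optimal ::
    "'a measure \<Rightarrow> (nat \<Rightarrow> 'a \<Rightarrow> real) \<Rightarrow> nat \<Rightarrow> nat \<Rightarrow> real \<Rightarrow> bool" where
  "minimax_optimal M X n k r \<longleftrightarrow>
     is_arg_min (\<lambda>r. SUP \<psi>\<in>Psi n k. Hbar M X n r \<psi>) (\<lambda>_. True) r"

definition inner_optimal ::
    "'a measure \<Rightarrow> (nat \<Rightarrow> 'a \<Rightarrow> real) \<Rightarrow> nat \<Rightarrow> nat \<Rightarrow> real \<Rightarrow> (nat \<Rightarrow> real) \<Rightarrow> bool" where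
  "inner_optimal M X n k r \<psi> \<longleftrightarrow> is_arg_max (Hbar M X n r) (\<lambda>\<psi>. \<psi> \<in> Psi n k) \<psi>"

end

theory Submission
  imports Defs
begin

text \<open>
  The inner maximum is a maximum of finitely many functions
  \<open>f\<^sub>A(r) = r + (\<Sum>i\<in>A. G\<^sub>i(r))\<close>, one for each \<open>k\<close>-subset \<open>A\<close>, and continuity of the distribution
  functions makes each of them differentiable with derivative \<open>1 - (\<Sum>i\<in>A. Pr[X\<^sub>i \<ge> r])\<close>. At a
  minimiser \<open>r*\<close> of the maximum, some active \<open>f\<^sub>A\<close> has derivative \<open>\<ge> 0\<close> and some active \<open>f\<^sub>B\<close> has
  derivative \<open>\<le> 0\<close>. Elements of \<open>A - B\<close> and \<open>B - A\<close> all have the same value \<open>G\<^sub>i(r*)\<close>, so \<open>A\<close> can be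
  turned into \<open>B\<close> by single exchanges that preserve optimality. At the exchange where
  \<open>\<Sum>i\<in>A. Pr[X\<^sub>i \<ge> r*]\<close> crosses 1, a convex combination of the two sets has just two fractional
  coordinates.
\<close>

section \<open>Derivative of the expected excess\<close>

text \<open>For each fixed value of \<open>Y \<omega>\<close>, the convex function
  \<open>u \<mapsto> max (Y \<omega> - u) 0\<close> lies above its support line at \<open>r\<close>
  with slope minus the indicator of \<open>r \<le> Y \<omega>\<close>. Integrating this pointwise
  bound gives the claim.\<close>

lemma (in prob_space) expected_excess_subgradient:
  fixes Y :: "'a \<Rightarrow> real"
  assumes Y: "integrable M Y"
  shows "(\<integral>\<omega>. max (Y \<omega> - r) 0 \<partial>M) - (s - r) * prob {\<omega> \<in> space M. r \<le> Y \<omega>}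
           \<le> (\<integral>\<omega>. max (Y \<omega> - s) 0 \<partial>M)"
proof -
  have Ym: "Y \<in> borel_measurable M"
    using Y by simp
  have ev: "{\<omega> \<in> space M. r \<le> Y \<omega>} \<in> events"
    using Ym by measurable
  have int: "integrable M (\<lambda>\<omega>. max (Y \<omega> - u) 0)" for u
    using Y by simp
  have ind: "integrable M (indicat_real {\<omega> \<in> space M. r \<le> Y \<omega>})"
    using ev by (intro integrable_real_indicator) (auto simp: less_top[symmetric])
  have "(\<integral>\<omega>. max (Y \<omega> - r) 0 \<partial>M) - (s - r) * prob {\<omega> \<in> space M. r \<le> Y \<omega>}
      = (\<integral>\<omega>. max (Y \<omega> - r) 0 - (s - r) * indicat_real {\<omega> \<in> space M. r \<le> Y \<omega>} \<omega> \<partial>M)"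
    using int[of r] ind ev by simp
  also have "\<dots> \<le> (\<integral>\<omega>. max (Y \<omega> - s) 0 \<partial>M)"
    by (rule integral_mono[OF Bochner_Integration.integrable_diff[OF int integrable_mult_right[OF ind]] int])
      (auto simp: indicator_def max_def)
  finally show ?thesis .
qed

text \<open>The support lines at \<open>r\<close> and at \<open>s\<close> trap the difference
  quotient between \<open>- p r\<close> and \<open>- p s\<close>. Continuity of the distribution
  function makes \<open>p\<close> continuous, so the quotient is squeezed to
  \<open>- p r\<close>.\<close>

lemma (in prob_space) expected_excess_has_derivative:
  fixes Y :: "'a \<Rightarrow> real"
  assumes Y: "integrable M Y"
    and cont: "continuous_on UNIV (cdf (distr M borel Y))"
  shows "((\<lambda>r. \<integral>\<omega>. max (Y \<omega> - r) 0 \<partial>M) has_real_derivative - prob {\<omega> \<in> space M. r \<le> Y \<omega>}) (at r)"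
proof -
  define E where "E = (\<lambda>r. \<integral>\<omega>. max (Y \<omega> - r) 0 \<partial>M)"
  define p where "p = (\<lambda>r. prob {\<omega> \<in> space M. r \<le> Y \<omega>})"
  have Ym [measurable]: "Y \<in> borel_measurable M"
    using Y by simp
  interpret D: prob_space "distr M borel Y"
    by (rule prob_space_distr) (rule Ym)
  interpret D: finite_borel_measure "distr M borel Y"
    by unfold_locales simp
  have isC: "isCont (cdf (distr M borel Y)) u" for u
    using cont by (simp add: continuous_on_eq_continuous_at)
  \<comment> \<open>A continuous distribution function has no atoms, so the weak inequality in
    \<open>p\<close> may be traded for a strict one.\<close>
  have p_eq: "p u = 1 - cdf (distr M borel Y) u" for u
  proof -
    have "measure (distr M borel Y) {u} = 0"
      using isC[of u] by (simp add: D.isCont_cdf)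
    then have "measure (distr M borel Y) {..u} = measure (distr M borel Y) {..<u}"
      using D.finite_measure_Union[of "{..<u}" "{u}"] ivl_disj_un_singleton(2)[of u] by simp
    also have "\<dots> = 1 - measure (distr M borel Y) {u..}"
      using D.prob_compl[of "{u..}"] by (simp add: Compl_atLeast Compl_eq_Diff_UNIV[symmetric])
    also have "measure (distr M borel Y) {u..} = p u"
      unfolding p_def by (subst measure_distr) (auto intro!: arg_cong[where f = prob])
    finally show ?thesis
      by (simp add: cdf_def)
  qed
  have p_cont: "p \<midarrow>r\<rightarrow> p r"
    using isC[of r] unfolding p_eq isCont_def by (intro tendsto_intros)
  have sub: "E r - (s - r) * p r \<le> E s" and sub': "E s - (r - s) * p s \<le> E r" for s
    unfolding E_def p_def by (rule expected_excess_subgradient[OF Y])+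
  have bound: "\<bar>(E s - E r) / (s - r) + p r\<bar> \<le> \<bar>p s - p r\<bar>" if "s \<noteq> r" for s
  proof -
    have "\<bar>E s - E r + (s - r) * p r\<bar> \<le> \<bar>(s - r) * (p s - p r)\<bar>"
      using sub[of s] sub'[of s] by (simp add: algebra_simps)
    then have "\<bar>E s - E r + (s - r) * p r\<bar> / \<bar>s - r\<bar> \<le> \<bar>p s - p r\<bar>"
      using that by (simp add: abs_mult divide_simps mult.commute)
    moreover have "(E s - E r) / (s - r) + p r = (E s - E r + (s - r) * p r) / (s - r)"
      using that by (simp add: field_simps)
    ultimately show ?thesis
      by simp
  qed
  have "((\<lambda>s. (E s - E r) / (s - r) + p r) \<longlongrightarrow> 0) (at r)"
  proof (rule Lim_null_comparison)
    show "\<forall>\<^sub>F s in at r. norm ((E s - E r) / (s - r) + p r) \<le> \<bar>p s - p r\<bar>"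
      using bound by (auto simp: eventually_at_filter)
    show "((\<lambda>s. \<bar>p s - p r\<bar>) \<longlongrightarrow> 0) (at r)"
      using p_cont by (simp add: tendsto_rabs_zero_iff LIM_zero_iff)
  qed
  from tendsto_diff[OF this tendsto_const[of "p r"]]
  have "((\<lambda>s. (E s - E r) / (s - r)) \<longlongrightarrow> - p r) (at r)"
    by simp
  then show ?thesis
    unfolding has_field_derivative_iff E_def p_def .
qed

section \<open>First-order conditions at a minimiser of a finite maximum\<close>

text \<open>Otherwise every active function drops strictly below \<open>F x\<close> just to the
  right of \<open>x\<close>, while the inactive ones stay below by continuity. Since
  \<open>S\<close> is finite, some \<open>y > x\<close> works for all of them at once, and there
  \<open>F y < F x\<close>.\<close>

lemma minimizer_of_max_active_deriv_nonneg:
  fixes f :: "'b \<Rightarrow> real \<Rightarrow> real"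
  assumes fin: "finite S"
    and deriv: "\<And>A. A \<in> S \<Longrightarrow> (f A has_real_derivative d A) (at x)"
    and upper: "\<And>A. A \<in> S \<Longrightarrow> f A x \<le> F x"
    and attained: "\<And>y. \<exists>A\<in>S. F y \<le> f A y"
    and min: "\<And>y. F x \<le> F y"
  shows "\<exists>A\<in>S. f A x = F x \<and> 0 \<le> d A"
proof (rule ccontr)
  assume neg: "\<not> ?thesis"
  have "\<forall>\<^sub>F y in at_right x. f A y < F x" if A: "A \<in> S" for A
  proof (cases "f A x = F x")
    case True
    then have "d A < 0"
      using neg A by force
    from DERIV_neg_dec_right[OF deriv[OF A] this] obtain e
      where e: "e > 0" "\<And>h. 0 < h \<Longrightarrow> h < e \<Longrightarrow> f A (x + h) < f A x"
      by auto
    show ?thesis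
      unfolding eventually_at_right_field
    proof (intro exI[of _ "x + e"] conjI allI impI)
      fix y assume "x < y" "y < x + e"
      then show "f A y < F x"
        using e(2)[of "y - x"] True by simp
    qed (use e in simp)
  next
    case False
    then have "f A x < F x"
      using upper[OF A] by simp
    moreover have "(f A \<longlongrightarrow> f A x) (at_right x)"
      using DERIV_isCont[OF deriv[OF A]] unfolding isCont_def
      by (rule tendsto_within_subset) simp
    ultimately show ?thesis
      by (rule order_tendstoD(2)[rotated])
  qed
  then have "\<forall>\<^sub>F y in at_right x. \<forall>A\<in>S. f A y < F x"
    by (intro eventually_ball_finite fin) blast
  then obtain y where "\<forall>A\<in>S. f A y < F x"
    using eventually_happens'[OF trivial_limit_at_right_real] by blast
  then show False
    using attained[of y] min[of y] by force
qed

lemma minimizer_of_max_active_deriv_nonpos: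
  fixes f :: "'b \<Rightarrow> real \<Rightarrow> real"
  assumes fin: "finite S"
    and deriv: "\<And>A. A \<in> S \<Longrightarrow> (f A has_real_derivative d A) (at x)"
    and upper: "\<And>A. A \<in> S \<Longrightarrow> f A x \<le> F x"
    and attained: "\<And>y. \<exists>A\<in>S. F y \<le> f A y"
    and min: "\<And>y. F x \<le> F y"
  shows "\<exists>A\<in>S. f A x = F x \<and> d A \<le> 0"
proof -
  \<comment> \<open>Reflecting the real line reduces this to the previous lemma.\<close>
  have "((\<lambda>y. f A (- y)) has_real_derivative - d A) (at (- x))" if "A \<in> S" for A
    using deriv[OF that] DERIV_mirror[of "f A" "d A" "- x"] by simp
  then have "\<exists>A\<in>S. f A (- (- x)) = F (- (- x)) \<and> 0 \<le> - d A"
    using fin upper attained min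
    by (intro minimizer_of_max_active_deriv_nonneg
          [where f = "\<lambda>A y. f A (- y)" and F = "\<lambda>y. F (- y)"]) auto
  then show ?thesis
    by simp
qed

section \<open>Maximum-weight subsets of given size\<close>

text \<open>For the weights \<open>G M X i r\<close> on \<open>{1..n}\<close>, the indicators of
  these sets are the integral maximisers of \<open>Hbar M X n r\<close> over
  \<open>Psi n k\<close>.\<close>

definition max_weight_subset :: "('b \<Rightarrow> real) \<Rightarrow> 'b set \<Rightarrow> nat \<Rightarrow> 'b set \<Rightarrow> bool" where
  "max_weight_subset g I k A \<longleftrightarrow>
     A \<subseteq> I \<and> card A = k \<and> (\<forall>B. B \<subseteq> I \<and> card B = k \<longrightarrow> sum g B \<le> sum g A)"

lemma max_weight_subset_exists:
  assumes "finite I" "k \<le> card I"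
  obtains A where "max_weight_subset g I k A"
proof -
  let ?S = "{A. A \<subseteq> I \<and> card A = k}"
  have "finite ?S"
    using assms by simp
  moreover have "?S \<noteq> {}"
    using obtain_subset_with_card_n[OF assms(2)] by blast
  ultimately have "Max (sum g ` ?S) \<in> sum g ` ?S" and ge: "\<And>B. B \<in> ?S \<Longrightarrow> sum g B \<le> Max (sum g ` ?S)"
    by (auto intro!: Max_in)
  then obtain A where "A \<in> ?S" "sum g A = Max (sum g ` ?S)"
    by auto
  then have "max_weight_subset g I k A"
    using ge unfolding max_weight_subset_def by auto
  then show thesis ..
qed

lemma sum_exchange:
  fixes g :: "'b \<Rightarrow> real"
  assumes "finite A" "a \<in> A" "b \<notin> A"
  shows "sum g (insert b (A - {a})) = sum g A - g a + g b"
  using assms by (simp add: sum_diff1)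

lemma card_exchange:
  assumes "finite A" "a \<in> A" "b \<notin> A"
  shows "card (insert b (A - {a})) = card A"
  using assms by (metis card_Suc_Diff1 card_insert_disjoint finite_Diff Diff_iff)

text \<open>Otherwise exchanging \<open>a\<close> for \<open>b\<close> would increase the
  weight.\<close>

lemma max_weight_subset_threshold:
  assumes fin: "finite I" and A: "max_weight_subset g I k A"
    and ab: "a \<in> A" "b \<in> I - A"
  shows "g b \<le> g a"
proof -
  have finA: "finite A"
    using A fin unfolding max_weight_subset_def by (auto intro: finite_subset)
  let ?B = "insert b (A - {a})"
  have "?B \<subseteq> I" "card ?B = k"
    using A ab card_exchange[OF finA] unfolding max_weight_subset_def by auto
  then have "sum g ?B \<le> sum g A"
    using A unfolding max_weight_subset_def by blast
  then show ?thesis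
    using sum_exchange[OF finA, of a b g] ab by simp
qed

text \<open>Subtracting the threshold \<open>t\<close> from all weights changes both sides by
  \<open>t * k\<close>, as both have total mass \<open>k\<close>. The shifted weights are
  nonnegative on \<open>A\<close> and nonpositive off \<open>A\<close>, so the indicator of
  \<open>A\<close> is best in each coordinate separately.\<close>

lemma fractional_weight_le_max_weight_subset:
  fixes \<psi> :: "'b \<Rightarrow> real"
  assumes fin: "finite I" and k: "1 \<le> k" and A: "max_weight_subset g I k A"
    and \<psi>: "\<And>i. i \<in> I \<Longrightarrow> 0 \<le> \<psi> i" "\<And>i. i \<in> I \<Longrightarrow> \<psi> i \<le> 1" "sum \<psi> I = k"
  shows "(\<Sum>i\<in>I. g i * \<psi> i) \<le> sum g A"
proof -
  have AI: "A \<subseteq> I" and cA: "card A = k"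
    using A unfolding max_weight_subset_def by auto
  have finA: "finite A" "A \<noteq> {}"
    using AI fin k cA by (auto intro: finite_subset)
  define t where "t = Min (g ` A)"
  have above: "t \<le> g i" if "i \<in> A" for i
    using that finA unfolding t_def by simp
  have below: "g i \<le> t" if "i \<in> I - A" for i
  proof -
    have "t \<in> g ` A"
      using finA unfolding t_def by (intro Min_in) auto
    then obtain a where "a \<in> A" "t = g a"
      by blast
    then show ?thesis
      using max_weight_subset_threshold[OF fin A _ that] by simp
  qed
  have "(\<Sum>i\<in>I. g i * \<psi> i) = (\<Sum>i\<in>I. (g i - t) * \<psi> i) + t * k"
    using \<psi>(3) by (simp add: left_diff_distrib sum_subtractf flip: sum_distrib_left)
  also have "(\<Sum>i\<in>I. (g i - t) * \<psi> i) \<le> (\<Sum>i\<in>I. if i \<in> A then g i - t else 0)"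
  proof (rule sum_mono)
    fix i assume i: "i \<in> I"
    show "(g i - t) * \<psi> i \<le> (if i \<in> A then g i - t else 0)"
      using above[of i] below[of i] \<psi>(1,2)[OF i] i
      by (auto intro: mult_left_le mult_nonpos_nonneg)
  qed
  also have "\<dots> = (\<Sum>i\<in>A. g i - t)"
    using fin AI by (simp add: sum.If_cases Int_absorb1)
  also have "\<dots> + t * k = sum g A"
    by (simp add: sum_subtractf cA)
  finally show ?thesis
    by simp
qed

text \<open>A discrete intermediate value argument: \<open>A\<close> is moved towards
  \<open>B\<close> by single exchanges among maximum-weight sets, and \<open>C\<close>,
  \<open>D\<close> are consecutive sets between which \<open>w\<close> crosses
  \<open>c\<close>.\<close>

lemma max_weight_subset_exchange:
  fixes g w :: "'b \<Rightarrow> real"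
  assumes fin: "finite I"
    and A: "max_weight_subset g I k A" and B: "max_weight_subset g I k B"
    and wA: "sum w A \<le> c" and wB: "c \<le> sum w B"
  obtains C D a b where
    "max_weight_subset g I k C" "max_weight_subset g I k D"
    "sum w C \<le> c" "c \<le> sum w D" "C - D \<subseteq> {a}" "D - C \<subseteq> {b}"
proof -
  have "\<exists>C D a b. max_weight_subset g I k C \<and> max_weight_subset g I k D \<and>
      sum w C \<le> c \<and> c \<le> sum w D \<and> C - D \<subseteq> {a} \<and> D - C \<subseteq> {b}"
    using A wA
  proof (induction "card (B - A)" arbitrary: A rule: less_induct)
    case less
    have sub: "A \<subseteq> I" "B \<subseteq> I" and cards: "card A = k" "card B = k"
      using less.prems B unfolding max_weight_subset_def by auto
    have finA: "finite A" and finB: "finite B"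
      using sub fin by (auto intro: finite_subset)
    show ?case
    proof (cases "A = B")
      case True
      \<comment> \<open>Here \<open>w\<close> sums to exactly \<open>c\<close>, so
        \<open>C = D = A\<close> works with any \<open>a\<close> and \<open>b\<close>.\<close>
      then show ?thesis
        using B less.prems wB by blast
    next
      case False
      then obtain a where a: "a \<in> A" "a \<notin> B"
        using card_subset_eq[OF finB, of A] cards by auto
      obtain b where b: "b \<in> B" "b \<notin> A"
        using False card_subset_eq[OF finA, of B] cards by auto
      \<comment> \<open>Applying the threshold property to \<open>A\<close> and to \<open>B\<close>
        gives both inequalities, so the exchange keeps the weight maximal.\<close>
      have "g b \<le> g a"
        by (rule max_weight_subset_threshold[OF fin less.prems(1)]) (use a b sub in auto)
      moreover have "g a \<le> g b"
        by (rule max_weight_subset_threshold[OF fin B]) (use a b sub in auto)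
      ultimately have eq: "g a = g b"
        by simp
      let ?D = "insert b (A - {a})"
      have D: "max_weight_subset g I k ?D"
        using less.prems(1) sum_exchange[OF finA a(1) b(2), of g] card_exchange[OF finA a(1) b(2)] b sub eq
        unfolding max_weight_subset_def by auto
      show ?thesis
      proof (cases "sum w ?D \<le> c")
        case True
        \<comment> \<open>The level \<open>c\<close> is not yet passed, so \<open>?D\<close> takes
          the role of \<open>A\<close>, one element closer to \<open>B\<close>.\<close>
        have "B - ?D \<subset> B - A"
          using a b by auto
        then have "card (B - ?D) < card (B - A)"
          using finB by (intro psubset_card_mono) auto
        then show ?thesis
          using less.hyps[OF _ D True] by blast
      next
        case False
        have "A - ?D \<subseteq> {a}" "?D - A \<subseteq> {b}"
          by auto
        then show ?thesis
          using False less.prems D by (meson linear)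
      qed
    qed
  qed
  then show thesis
    using that by blast
qed

section \<open>Convex combinations of subsets in the scaled simplex\<close>

text \<open>The restricted abstraction makes the value \<open>undefined\<close> outside
  \<open>{1..n}\<close>, as membership in \<open>Psi\<close> demands.\<close>

definition mix :: "nat \<Rightarrow> real \<Rightarrow> nat set \<Rightarrow> nat set \<Rightarrow> nat \<Rightarrow> real" where
  "mix n t C D = (\<lambda>i\<in>{1..n}. (1 - t) * indicator C i + t * indicator D i)"

lemma sum_mix:
  assumes "C \<subseteq> {1..n}" "D \<subseteq> {1..n}"
  shows "(\<Sum>i\<in>{1..n}. g i * mix n t C D i) = (1 - t) * sum g C + t * sum g D"
proof -
  have ind: "(\<Sum>i\<in>{1..n}. g i * indicator S i) = sum g S" if "S \<subseteq> {1..n}" for S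
    using that by (intro sum.mono_neutral_cong_right) auto
  have "(\<Sum>i\<in>{1..n}. g i * mix n t C D i)
      = (\<Sum>i\<in>{1..n}. (1 - t) * (g i * indicator C i) + t * (g i * indicator D i))"
    by (intro sum.cong) (auto simp: mix_def algebra_simps)
  also have "\<dots> = (1 - t) * (\<Sum>i\<in>{1..n}. g i * indicator C i) + t * (\<Sum>i\<in>{1..n}. g i * indicator D i)"
    by (simp only: sum.distrib sum_distrib_left)
  finally show ?thesis
    using assms by (simp only: ind)
qed

lemma mix_in_Psi:
  assumes "C \<subseteq> {1..n}" "D \<subseteq> {1..n}" "card C = k" "card D = k" "0 \<le> t" "t \<le> 1"
  shows "mix n t C D \<in> Psi n k"
proof -
  have range: "0 \<le> mix n t C D i \<and> mix n t C D i \<le> 1" if "i \<in> {1..n}" for i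
    using that assms(5,6) by (auto simp: mix_def indicator_def)
  then have "(\<Sum>i\<in>{1..n}. \<bar>mix n t C D i\<bar>) = (\<Sum>i\<in>{1..n}. 1 * mix n t C D i)"
    by (intro sum.cong) auto
  also have "\<dots> = real k"
    using sum_mix[OF assms(1,2), of "\<lambda>_. 1"] assms(3,4) by (simp add: algebra_simps)
  finally show ?thesis
    using range unfolding Psi_def by (auto simp: mix_def)
qed

text \<open>A coordinate is 0 or 1 unless it lies in exactly one of \<open>C\<close> and
  \<open>D\<close>.\<close>

lemma card_fractional_mix_le_2:
  assumes "C - D \<subseteq> {a}" "D - C \<subseteq> {b}"
  shows "card {i \<in> {1..n}. mix n t C D i \<notin> \<int>} \<le> 2"
proof -
  have "{i \<in> {1..n}. mix n t C D i \<notin> \<int>} \<subseteq> {a, b}"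
  proof
    fix i assume i: "i \<in> {i \<in> {1..n}. mix n t C D i \<notin> \<int>}"
    then have "i \<in> C \<longleftrightarrow> i \<notin> D"
      by (cases "i \<in> C"; cases "i \<in> D") (auto simp: mix_def)
    then show "i \<in> {a, b}"
      using assms by auto
  qed
  then have "card {i \<in> {1..n}. mix n t C D i \<notin> \<int>} \<le> card {a, b}"
    by (intro card_mono) auto
  also have "\<dots> \<le> 2"
    by (simp add: card_insert_if)
  finally show ?thesis .
qed

lemma Hbar_mix:
  assumes "C \<subseteq> {1..n}" "D \<subseteq> {1..n}"
  shows "Hbar M X n r (mix n t C D)
           = r + ((1 - t) * (\<Sum>i\<in>C. G M X i r) + t * (\<Sum>i\<in>D. G M X i r))"
  unfolding Hbar_def by (simp only: sum_mix[OF assms])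

lemma Hbar_le_max_weight_subset:
  assumes "1 \<le> k" "max_weight_subset (\<lambda>i. G M X i r) {1..n} k A" "\<psi> \<in> Psi n k"
  shows "Hbar M X n r \<psi> \<le> r + (\<Sum>i\<in>A. G M X i r)"
proof -
  have \<psi>: "0 \<le> \<psi> i" "\<psi> i \<le> 1" if "i \<in> {1..n}" for i
    using assms(3) that unfolding Psi_def by (auto dest: PiE_mem)
  then have "sum \<psi> {1..n} = k"
    using assms(3) unfolding Psi_def by simp
  then show ?thesis
    using fractional_weight_le_max_weight_subset[OF _ assms(1,2)] \<psi> unfolding Hbar_def by simp
qed

lemma SUP_Hbar_eq:
  assumes k: "1 \<le> k" and A: "max_weight_subset (\<lambda>i. G M X i r) {1..n} k A"
  shows "(SUP \<psi>\<in>Psi n k. Hbar M X n r \<psi>) = r + (\<Sum>i\<in>A. G M X i r)"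
proof (rule cSup_eq_maximum)
  have A': "A \<subseteq> {1..n}" "card A = k"
    using A unfolding max_weight_subset_def by auto
  \<comment> \<open>\<open>mix n 0 A A\<close> is the indicator of \<open>A\<close>; it attains the
    upper bound.\<close>
  have "Hbar M X n r (mix n 0 A A) \<in> Hbar M X n r ` Psi n k"
    using A' by (intro imageI mix_in_Psi) auto
  then show "r + (\<Sum>i\<in>A. G M X i r) \<in> Hbar M X n r ` Psi n k"
    using Hbar_mix[OF A'(1) A'(1), of M X r 0] by simp
qed (use Hbar_le_max_weight_subset[OF assms] in auto)

theorem theorem4:
  fixes M :: "'a measure" and X :: "nat \<Rightarrow> 'a \<Rightarrow> real" and n k :: nat and rstar :: real
  assumes "prob_space M"
    and "1 \<le> k" and "k \<le> n"
    and "prob_space.indep_vars M (\<lambda>_. borel) X {1..n}"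
    and "\<And>i. i \<in> {1..n} \<Longrightarrow> AE \<omega> in M. 0 \<le> X i \<omega>"
    and "\<And>i. i \<in> {1..n} \<Longrightarrow> integrable M (X i)"
    and "\<And>i. i \<in> {1..n} \<Longrightarrow> continuous_on UNIV (cdf (distr M borel (X i)))"
    and "minimax_optimal M X n k rstar"
  shows "\<exists>\<psi>. inner_optimal M X n k rstar \<psi>
           \<and> (\<Sum>i\<in>{1..n}. measure M {\<omega> \<in> space M. X i \<omega> \<ge> rstar} * \<psi> i) = 1
           \<and> card {i \<in> {1..n}. \<psi> i \<notin> \<int>} \<le> 2"
proof -
  interpret prob_space M
    by fact
  note k = \<open>1 \<le> k\<close> \<open>k \<le> n\<close>
  define I where "I = {1..n}"
  define S where "S = {A. A \<subseteq> I \<and> card A = k}"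
  define g where "g = (\<lambda>r i. G M X i r)"
  define p where "p = (\<lambda>i. prob {\<omega> \<in> space M. rstar \<le> X i \<omega>})"
  define f where "f = (\<lambda>A r. r + (\<Sum>i\<in>A. g r i))"
  define F where "F = (\<lambda>r. SUP \<psi>\<in>Psi n k. Hbar M X n r \<psi>)"
  have fin: "finite I" "finite S"
    by (auto simp: I_def S_def)
  have F_eq: "F r = f A r" if "max_weight_subset (g r) I k A" for r A
    using SUP_Hbar_eq[OF k(1)] that unfolding F_def f_def g_def I_def by blast
  have maximal: "\<exists>A. max_weight_subset (g r) I k A" for r
    using max_weight_subset_exists[OF fin(1), of k "g r"] k unfolding I_def by auto
  have upper: "f A r \<le> F r" if "A \<in> S" for A r
    using maximal[of r] F_eq[of r] that
    unfolding max_weight_subset_def S_def f_def by fastforce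
  \<comment> \<open>This is shown at every \<open>r\<close>, since the first-order conditions
    compare \<open>F rstar\<close> with values at nearby points.\<close>
  have attained: "\<exists>A\<in>S. F r \<le> f A r" for r
  proof -
    obtain A where A: "max_weight_subset (g r) I k A"
      using maximal by blast
    then have "A \<in> S"
      unfolding max_weight_subset_def S_def by blast
    then show ?thesis
      using F_eq[OF A] by auto
  qed
  have min: "F rstar \<le> F r" for r
    using assms(8) unfolding minimax_optimal_def is_arg_min_def F_def
    by (meson linorder_not_le)
  have deriv_g: "((\<lambda>r. g r i) has_real_derivative - p i) (at rstar)" if "i \<in> I" for i
    using expected_excess_has_derivative[OF assms(6,7), of i rstar] that
    unfolding g_def G_def p_def I_def by simp
  have deriv: "(f A has_real_derivative 1 - sum p A) (at rstar)" if "A \<in> S" for A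
  proof -
    have "((\<lambda>r. r + (\<Sum>i\<in>A. g r i)) has_real_derivative 1 + (\<Sum>i\<in>A. - p i)) (at rstar)"
      using that by (intro derivative_intros deriv_g) (auto simp: S_def)
    then show ?thesis
      by (simp add: f_def sum_negf)
  qed
  have active: "max_weight_subset (g rstar) I k A" if "A \<in> S" "f A rstar = F rstar" for A
    unfolding max_weight_subset_def
  proof (intro conjI allI impI)
    fix B assume "B \<subseteq> I \<and> card B = k"
    then have "f B rstar \<le> f A rstar"
      using upper[of B rstar] that unfolding S_def by simp
    then show "sum (g rstar) B \<le> sum (g rstar) A"
      unfolding f_def by simp
  qed (use that in \<open>simp_all add: S_def\<close>)
  obtain A where A: "A \<in> S" "f A rstar = F rstar" "0 \<le> 1 - sum p A"
    using minimizer_of_max_active_deriv_nonneg[OF fin(2) deriv upper attained min] by blast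
  obtain B where B: "B \<in> S" "f B rstar = F rstar" "1 - sum p B \<le> 0"
    using minimizer_of_max_active_deriv_nonpos[OF fin(2) deriv upper attained min] by blast
  have "sum p A \<le> 1" "1 \<le> sum p B"
    using A(3) B(3) by simp_all
  with fin(1) active[OF A(1,2)] active[OF B(1,2)] obtain C D a b where
    C: "max_weight_subset (g rstar) I k C" and D: "max_weight_subset (g rstar) I k D"
    and pC: "sum p C \<le> 1" and pD: "1 \<le> sum p D" and CD: "C - D \<subseteq> {a}" "D - C \<subseteq> {b}"
    by (rule max_weight_subset_exchange)
  have sub: "C \<subseteq> {1..n}" "D \<subseteq> {1..n}" and cards: "card C = k" "card D = k"
    using C D unfolding max_weight_subset_def I_def by auto
  \<comment> \<open>The sums over \<open>C\<close> and \<open>D\<close> enclose 1. If the first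
    equals 1, \<open>t = 0\<close> works; otherwise they differ and the linear equation can be
    solved for \<open>t\<close>.\<close>
  obtain t where t: "0 \<le> t" "t \<le> 1" "(1 - t) * sum p C + t * sum p D = 1"
  proof (cases "sum p C = 1")
    case True
    then show thesis
      using that[of 0] by simp
  next
    case False
    let ?t = "(1 - sum p C) / (sum p D - sum p C)"
    have lt: "sum p C < sum p D"
      using False pC pD by simp
    have "(1 - ?t) * sum p C + ?t * sum p D = sum p C + ?t * (sum p D - sum p C)"
      by (simp only: algebra_simps)
    also have "\<dots> = 1"
      using lt by simp
    finally show thesis
      using that[of ?t] lt pC pD by (simp add: divide_simps)
  qed
  let ?\<psi> = "mix n t C D"
  have H\<psi>: "Hbar M X n rstar ?\<psi> = F rstar"
  proof -
    \<comment> \<open>Both sets have maximum weight, so the objective is constant along the segment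
      and any \<open>t\<close> preserves optimality.\<close>
    have "sum (g rstar) D = sum (g rstar) C"
      using F_eq[OF C] F_eq[OF D] unfolding f_def by simp
    then have "Hbar M X n rstar ?\<psi> = f C rstar"
      unfolding Hbar_mix[OF sub] f_def g_def by (simp add: algebra_simps)
    then show ?thesis
      using F_eq[OF C] by simp
  qed
  have "inner_optimal M X n k rstar ?\<psi>"
    unfolding inner_optimal_def is_arg_max_linorder
  proof (intro conjI allI impI)
    show "?\<psi> \<in> Psi n k"
      by (rule mix_in_Psi[OF sub cards t(1,2)])
    fix \<psi> assume "\<psi> \<in> Psi n k"
    then have "Hbar M X n rstar \<psi> \<le> f C rstar"
      using Hbar_le_max_weight_subset[OF k(1)] C unfolding f_def g_def I_def by blast
    then show "Hbar M X n rstar \<psi> \<le> Hbar M X n rstar ?\<psi>"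
      using H\<psi> F_eq[OF C] by simp
  qed
  moreover have "(\<Sum>i\<in>{1..n}. p i * ?\<psi> i) = 1"
    using sum_mix[OF sub] t(3) by simp
  moreover have "card {i \<in> {1..n}. ?\<psi> i \<notin> \<int>} \<le> 2"
    by (rule card_fractional_mix_le_2[OF CD])
  ultimately show ?thesis
    unfolding p_def by blast
qed

end
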